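(* Let $R$ be a ring. Then the following are equivalent: (1) $R$ is Zhou nil-clean. (2) For any $a\in R$, there exist 2-idempotents $e,f\in \mathbb{Z}[a]$ and a nilpotent $w\in R$ such that $a=e+f+w$. (3) Every element in $R$ is the sum of two 2-idempotents and a nilpotent that (pairwise) commute.
   Context: All rings are associative with an identity, not necessarily commutative. An element $t$ of a ring is tripotent if $t^3=t$. An element $e$ of a ring is a 2-idempotent if $e^2$ is an idempotent, i.e. $e^2=e^4$. A ring $R$ is Zhou nil-clean if every element of $R$ is the sum of two tripotents and a nilpotent that (pairwise) commute. For $a\in R$, $\mathbb{Z}[a]=\{f(a) : f(t)\text{ is a polynomial with integral coefficients}\}\subseteq R$. *)

theory Defs
  imports "HOL-Algebra.Ring" "HOL-Computational_Algebra.Polynomial"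
begin

text \<open>Rings are those of the locale \<^locale>\<open>ring\<close>: associative with identity, not
  necessarily commutative; the zero ring is allowed.\<close>

definition tripotent :: "('a, 'm) ring_scheme \<Rightarrow> 'a \<Rightarrow> bool" where
  "tripotent R t \<longleftrightarrow> t \<in> carrier R \<and> t [^]\<^bsub>R\<^esub> (3::nat) = t"

definition ring_idempotent :: "('a, 'm) ring_scheme \<Rightarrow> 'a \<Rightarrow> bool" where
  "ring_idempotent R e \<longleftrightarrow> e \<in> carrier R \<and> e [^]\<^bsub>R\<^esub> (2::nat) = e"

definition two_idempotent :: "('a, 'm) ring_scheme \<Rightarrow> 'a \<Rightarrow> bool" where
  "two_idempotent R e \<longleftrightarrow> e \<in> carrier R \<and> ring_idempotent R (e [^]\<^bsub>R\<^esub> (2::nat))"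

definition nilpotent :: "('a, 'm) ring_scheme \<Rightarrow> 'a \<Rightarrow> bool" where
  "nilpotent R w \<longleftrightarrow> w \<in> carrier R \<and> (\<exists>n::nat. w [^]\<^bsub>R\<^esub> n = \<zero>\<^bsub>R\<^esub>)"

definition commute3 :: "('a, 'm) ring_scheme \<Rightarrow> 'a \<Rightarrow> 'a \<Rightarrow> 'a \<Rightarrow> bool" where
  "commute3 R x y z \<longleftrightarrow>
     x \<otimes>\<^bsub>R\<^esub> y = y \<otimes>\<^bsub>R\<^esub> x \<and> x \<otimes>\<^bsub>R\<^esub> z = z \<otimes>\<^bsub>R\<^esub> x \<and> y \<otimes>\<^bsub>R\<^esub> z = z \<otimes>\<^bsub>R\<^esub> y"

definition zhou_nil_clean :: "('a, 'm) ring_scheme \<Rightarrow> bool" where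
  "zhou_nil_clean R \<longleftrightarrow>
     (\<forall>a\<in>carrier R. \<exists>s t w. tripotent R s \<and> tripotent R t \<and> nilpotent R w \<and>
        commute3 R s t w \<and> a = s \<oplus>\<^bsub>R\<^esub> t \<oplus>\<^bsub>R\<^esub> w)"

text \<open>The library evaluation maps need the coefficients to lie in the ring (or a class
  instance), so integer polynomials are evaluated directly: \<open>[k] \<cdot>\<^bsub>R\<^esub> x\<close> is the integer
  multiple \<open>k x\<close>, and the constant term is multiplied with \<open>a [^]\<^bsub>R\<^esub> 0 = \<one>\<^bsub>R\<^esub>\<close>.\<close>

definition int_poly_eval :: "('a, 'm) ring_scheme \<Rightarrow> int poly \<Rightarrow> 'a \<Rightarrow> 'a" where
  "int_poly_eval R p a =
     (\<Oplus>\<^bsub>R\<^esub>i\<in>{..degree p}. [coeff p i] \<cdot>\<^bsub>R\<^esub> (a [^]\<^bsub>R\<^esub> (i::nat)))"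

definition int_adjoin :: "('a, 'm) ring_scheme \<Rightarrow> 'a \<Rightarrow> 'a set" where
  "int_adjoin R a = range (\<lambda>p. int_poly_eval R p a)"

end

theory Submission
  imports Defs
begin

text \<open>
  The cheap direction rests on one computation: if \<open>e\<^sup>4 = e\<^sup>2\<close>, then \<open>e\<^sup>3\<close> is tripotent and
  \<open>(e - e\<^sup>3)\<^sup>2 = 0\<close>. So each of two commuting 2-idempotents is a tripotent plus a nilpotent, and
  commuting nilpotents add up to a nilpotent. If \<open>e\<close> and \<open>f\<close> lie in \<open>\<int>[a]\<close>, then so does
  \<open>a - e - f\<close>, which is why commutativity is automatic in condition (2).

  The substance is to find \<open>e\<close> and \<open>f\<close> inside \<open>\<int>[a]\<close> when \<open>R\<close> is Zhou nil-clean. Two commuting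
  tripotents behave like elements of \<open>{-1, 0, 1}\<close>, so their sum behaves like one of the integers
  \<open>-2, \<dots>, 2\<close>. Hence every element \<open>a\<close> satisfies, up to a nilpotent, the equation
  \<open>a\<^sup>5 - 5a\<^sup>3 + 4a = (a-2)(a-1)a(a+1)(a+2) = 0\<close>
  (\<open>quintic_of_tripotent_sum\<close>). The element \<open>3\<close> then gives that \<open>120\<close>, hence \<open>30\<close>, is nilpotent.

  Modulo nilpotents only the characteristics 2, 3 and 5 survive, and \<open>a\<close> satisfies there
  \<open>a\<^sup>2 = a\<close>, \<open>a\<^sup>3 = a\<close> and \<open>a\<^sup>5 = a\<close> respectively. The splitting \<open>a = (a\<^sup>3 - a) + (2a - a\<^sup>3)\<close> works
  for all three at once. In characteristics 2 and 3 the first summand vanishes and the second is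
  \<open>a\<close>; in characteristic 5 the pairs of values are \<open>(0,0), (0,1), (1,1), (-1,-1), (0,-1)\<close> at
  \<open>0, \<dots>, 4\<close>. So both summands are tripotent modulo nilpotents
  (\<open>two_tripotents_decomposition\<close>).

  It remains to lift tripotents modulo nilpotents inside \<open>\<int>[a]\<close>. Newton iteration for
  \<open>x\<^sup>3 - x\<close> is unavailable, since the derivative at \<open>1\<close> is \<open>2\<close>, which need not be invertible. Instead
  the tripotent is written modulo nilpotents as a difference of two orthogonal idempotents, and
  idempotents always lift (\<open>tripotent_lift\<close>).

  All computations take place in commutative rings of integer polynomials, in one variable or in
  three, which are mapped to \<open>R\<close> by evaluation at commuting elements. A statement about \<open>R\<close> becomes a
  membership in the kernel of the evaluation (an equation) or in its radical (nilpotency).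
\<close>

section \<open>Lifting modulo the radical of an ideal\<close>

locale comm_ideal =
  fixes K :: "'c::comm_ring_1 set"
  assumes zero_mem: "0 \<in> K"
    and add_mem: "x \<in> K \<Longrightarrow> y \<in> K \<Longrightarrow> x + y \<in> K"
    and mult_mem: "x \<in> K \<Longrightarrow> r * x \<in> K"
begin

lemma mult_mem_right: "x \<in> K \<Longrightarrow> x * r \<in> K"
  using mult_mem[of x r] by (simp add: mult.commute)

lemma minus_mem: "x \<in> K \<Longrightarrow> - x \<in> K"
  using mult_mem[of x "-1"] by simp

lemma diff_mem: "x \<in> K \<Longrightarrow> y \<in> K \<Longrightarrow> x - y \<in> K"
  using add_mem[OF _ minus_mem[of y], of x] by simp

lemma sum_mem: "(\<And>i. i \<in> A \<Longrightarrow> f i \<in> K) \<Longrightarrow> sum f A \<in> K"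
  by (induction A rule: infinite_finite_induct) (auto simp: zero_mem add_mem)

lemma power_mem_mono: "x ^ m \<in> K \<Longrightarrow> m \<le> n \<Longrightarrow> x ^ n \<in> K"
  using mult_mem[of "x ^ m" "x ^ (n - m)"] by (simp flip: power_add)

definition rad :: "'c set" where
  "rad = {x. \<exists>n. x ^ n \<in> K}"

lemma radI: "x ^ n \<in> K \<Longrightarrow> x \<in> rad"
  by (auto simp: rad_def)

lemma mem_rad: "x \<in> K \<Longrightarrow> x \<in> rad"
  by (rule radI[of x 1]) simp

lemma rad_powerD: "x ^ n \<in> rad \<Longrightarrow> x \<in> rad"
  by (auto simp: rad_def simp flip: power_mult)

text \<open>In every term of the binomial expansion of \<open>(x + y)\<^sup>m\<^sup>+\<^sup>n\<close>, either \<open>x\<close> occurs at least \<open>m\<close>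
  times or \<open>y\<close> at least \<open>n\<close> times.\<close>

lemma rad_add:
  assumes "x \<in> rad" "y \<in> rad"
  shows "x + y \<in> rad"
proof -
  obtain m n where m: "x ^ m \<in> K" and n: "y ^ n \<in> K"
    using assms by (auto simp: rad_def)
  have "of_nat (m + n choose i) * x ^ i * y ^ (m + n - i) \<in> K" for i
  proof (cases "m \<le> i")
    case True
    then have "x ^ i \<in> K" by (rule power_mem_mono[OF m])
    then show ?thesis by (simp add: mult_mem mult_mem_right)
  next
    case False
    then have "y ^ (m + n - i) \<in> K" by (intro power_mem_mono[OF n]) simp
    then show ?thesis by (rule mult_mem)
  qed
  then have "(x + y) ^ (m + n) \<in> K"
    unfolding binomial_ring by (intro sum_mem)
  then show ?thesis by (rule radI)
qed

lemma rad_mult: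
  assumes "x \<in> rad"
  shows "r * x \<in> rad"
  using assms by (auto simp: rad_def power_mult_distrib intro: mult_mem)

lemma rad_minus: "x \<in> rad \<Longrightarrow> - x \<in> rad"
  using rad_mult[of x "-1"] by simp

lemma rad_diff: "x \<in> rad \<Longrightarrow> y \<in> rad \<Longrightarrow> x - y \<in> rad"
  using rad_add[OF _ rad_minus[of y], of x] by simp

text \<open>The Newton-type step \<open>x \<mapsto> 3x\<^sup>2 - 2x\<^sup>3\<close> changes \<open>x\<close> by a multiple of the defect
  \<open>x\<^sup>2 - x\<close> and replaces the defect by a multiple of its square. A defect whose \<open>n\<close>-th power lies in
  \<open>K\<close>, with \<open>n \<ge> 2\<close>, thus becomes one whose \<open>(n-1)\<close>-st power does, as \<open>2(n-1) \<ge> n\<close>.\<close>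

lemma idempotent_lift:
  assumes "x^2 - x \<in> rad"
  obtains e where "e^2 - e \<in> K" "e - x \<in> rad"
proof -
  obtain n where "(x^2 - x) ^ n \<in> K"
    using assms by (auto simp: rad_def)
  then have "\<exists>e. e^2 - e \<in> K \<and> e - x \<in> rad"
  proof (induction n arbitrary: x rule: less_induct)
    case (less n)
    consider "n \<le> 1" | "n \<ge> 2" by linarith
    then show ?case
    proof cases
      case 1
      then have "x^2 - x \<in> K"
        using power_mem_mono[OF less.prems, of 1] by simp
      then show ?thesis by (auto intro!: exI[of _ x] simp: mem_rad zero_mem)
    next
      case 2
      define y where "y = 3 * x^2 - 2 * x^3"
      have y1: "y^2 - y = (x^2 - x)^2 * (4 * x^2 - 4 * x - 3)"
        unfolding y_def by (simp add: ring_distribs eval_nat_numeral mult_ac)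
      have y2: "y - x = (1 - 2 * x) * (x^2 - x)"
        unfolding y_def by (simp add: ring_distribs eval_nat_numeral mult_ac)
      have "(x^2 - x) ^ (2 * (n - 1)) \<in> K"
        using 2 by (intro power_mem_mono[OF less.prems]) simp
      then have "(y^2 - y) ^ (n - 1) \<in> K"
        unfolding y1 power_mult_distrib power_mult by (rule mult_mem_right)
      then obtain e where e: "e^2 - e \<in> K" "e - y \<in> rad"
        using less.IH[of "n - 1" y] 2 by auto
      have "y - x \<in> rad"
        unfolding y2 by (intro rad_mult radI[OF less.prems])
      then have "(e - y) + (y - x) \<in> rad" by (intro rad_add e(2))
      then show ?thesis using e(1) by auto
    qed
  qed
  then show ?thesis using that by blast
qed

text \<open>Modulo \<open>K\<close> the element \<open>x\<close> agrees with all its positive powers.\<close>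

lemma idempotent_mem_if_rad:
  assumes "x^2 - x \<in> K" "x \<in> rad"
  shows "x \<in> K"
proof -
  have pow: "x - x ^ Suc n \<in> K" for n
  proof (induction n)
    case 0
    then show ?case by (simp add: zero_mem)
  next
    case (Suc n)
    have "x - x ^ Suc (Suc n) = (x - x ^ Suc n) - x ^ n * (x^2 - x)"
      by (simp add: algebra_simps power2_eq_square)
    then show ?case using Suc assms(1) by (simp only: diff_mem mult_mem)
  qed
  obtain n where "x ^ n \<in> K" using assms(2) by (auto simp: rad_def)
  then have "x ^ Suc n \<in> K" by (rule power_mem_mono) simp
  then have "(x - x ^ Suc n) + x ^ Suc n \<in> K" by (intro add_mem pow)
  then show ?thesis by simp
qed

text \<open>Where 2 is invertible, a tripotent \<open>g\<close> is the difference of the orthogonal idempotents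
  \<open>(g\<^sup>2 + g)/2\<close> and \<open>(g\<^sup>2 - g)/2\<close>; in characteristic 2, modulo nilpotents, it is itself
  idempotent. The polynomials \<open>8g\<^sup>2 + 23g\<close> and \<open>8g\<^sup>2 - 8g\<close> serve in both cases: 8 is the inverse
  of 2 modulo 15, and modulo 2 they reduce to \<open>g\<close> and \<open>0\<close>. Their difference \<open>31g\<close> is \<open>g\<close> up to a
  multiple of 30. The lifted idempotents stay orthogonal, because their product is idempotent modulo
  \<open>K\<close> and lies in the radical; hence their difference is tripotent.\<close>

lemma tripotent_lift:
  assumes thirty: "30 \<in> rad" and g: "g^3 - g \<in> rad"
  obtains e where "e^3 - e \<in> K" "e - g \<in> rad"
proof -
  define p where "p = 8 * g^2 + 23 * g"
  define q where "q = 8 * g^2 - 8 * g"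
  define c where "c = g^3 - g"
  have c: "c \<in> rad" using g by (simp add: c_def)
  have thirtyD: "r * 30 \<in> rad" for r using thirty by (rule rad_mult)
  have cD: "r * c \<in> rad" for r using c by (rule rad_mult)
  \<comment> \<open>For tripotent \<open>g\<close>, \<open>p\<^sup>2 - p\<close> reduces to \<open>15(39g\<^sup>2 + 23g)\<close>. The missing factor 2 of 30
    appears only after squaring, because \<open>g\<^sup>2 + g\<close> is just nilpotent, not zero, in characteristic 2.\<close>
  have "(15 * (39 * g^2 + 23 * g))^2
      = 15 * (1025 * g^2 + 897 * g) * 30 + 225 * (1521 * g + 1794) * c"
    unfolding c_def by (simp add: ring_distribs eval_nat_numeral mult_ac)
  also have "\<dots> \<in> rad" by (intro rad_add thirtyD cD)
  finally have "15 * (39 * g^2 + 23 * g) \<in> rad" by (rule rad_powerD)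
  moreover have "p^2 - p = 15 * (39 * g^2 + 23 * g) + (64 * g + 368) * c"
    unfolding p_def c_def by (simp add: ring_distribs eval_nat_numeral mult_ac)
  ultimately have "p^2 - p \<in> rad" by (simp add: rad_add cD)
  then obtain e where e: "e^2 - e \<in> K" "e - p \<in> rad" by (rule idempotent_lift)
  have "q^2 - q = 4 * (g^2 - g) * 30 + (64 * g - 128) * c"
    unfolding q_def c_def by (simp add: ring_distribs eval_nat_numeral mult_ac)
  also have "\<dots> \<in> rad" by (intro rad_add thirtyD cD)
  finally obtain f where f: "f^2 - f \<in> K" "f - q \<in> rad" by (rule idempotent_lift)
  have pq: "p * q = 4 * (g - g^2) * 30 + (64 * g + 120) * c"
    unfolding p_def q_def c_def by (simp add: ring_distribs eval_nat_numeral mult_ac)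
  have "p * q \<in> rad" unfolding pq by (intro rad_add thirtyD cD)
  moreover have "e * f = p * q + f * (e - p) + p * (f - q)" by (simp add: ring_distribs eval_nat_numeral mult_ac)
  ultimately have ef_rad: "e * f \<in> rad" using e(2) f(2) by (simp add: rad_add rad_mult)
  have "(e * f)^2 - e * f = f^2 * (e^2 - e) + e * (f^2 - f)"
    by (simp add: ring_distribs eval_nat_numeral mult_ac)
  then have "(e * f)^2 - e * f \<in> K" using e(1) f(1) by (simp add: add_mem mult_mem)
  then have ef: "e * f \<in> K" using ef_rad by (rule idempotent_mem_if_rad)
  show thesis
  proof
    have "(e - f)^3 - (e - f)
        = (e + 1) * (e^2 - e) - (f + 1) * (f^2 - f) + 3 * (f - e) * (e * f)" by (simp add: ring_distribs eval_nat_numeral mult_ac)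
    also have "\<dots> \<in> K" by (intro add_mem diff_mem mult_mem e(1) f(1) ef)
    finally show "(e - f)^3 - (e - f) \<in> K" .
    have "(e - f) - g = (e - p) - (f - q) + g * 30"
      unfolding p_def q_def by (simp add: ring_distribs eval_nat_numeral mult_ac)
    also have "\<dots> \<in> rad" by (intro rad_add rad_diff thirtyD e(2) f(2))
    finally show "(e - f) - g \<in> rad" .
  qed
qed

text \<open>With \<open>u = x\<^sup>3 - x\<close>, the quintic vanishes at the integers \<open>-2, \<dots>, 2\<close>, where \<open>u\<close> takes the
  values \<open>-6, 0, 0, 0, 6\<close>. Comparing values there gives, modulo the quintic, \<open>u\<^sup>3 = 36u\<close> and the
  defects \<open>35u\<close> and \<open>-10u\<close> for the cubes of \<open>u\<close> and \<open>x - u\<close>. Both are multiples of \<open>5u\<close>, which lies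
  in the radical since its cube is \<open>125 \<cdot> 36u = 30 \<cdot> 150u\<close>.\<close>

lemma two_tripotents_decomposition:
  assumes thirty: "30 \<in> rad" and P: "x^5 - 5 * x^3 + 4 * x \<in> rad"
  obtains e f where "e^3 - e \<in> K" "f^3 - f \<in> K" "x - e - f \<in> rad"
proof -
  define c where "c = x^5 - 5 * x^3 + 4 * x"
  define u where "u = x^3 - x"
  have c: "r * c \<in> rad" for r using P unfolding c_def by (rule rad_mult)
  have thirtyD: "r * 30 \<in> rad" for r using thirty by (rule rad_mult)
  have "(5 * u)^3 = 150 * u * 30 + 125 * (x^4 + 2 * x^2 + 9) * c"
    unfolding u_def c_def by (simp add: ring_distribs eval_nat_numeral mult_ac)
  also have "\<dots> \<in> rad" by (intro rad_add thirtyD c)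
  finally have "5 * u \<in> rad" by (rule rad_powerD)
  then have five: "r * (5 * u) \<in> rad" for r by (rule rad_mult)
  have "u^3 - u = 7 * (5 * u) + (x^4 + 2 * x^2 + 9) * c"
    unfolding u_def c_def by (simp add: ring_distribs eval_nat_numeral mult_ac)
  also have "\<dots> \<in> rad" by (intro rad_add five c)
  finally obtain e where e: "e^3 - e \<in> K" "e - u \<in> rad"
    by (rule tripotent_lift[OF thirty])
  have "(x - u)^3 - (x - u) = (- 2) * (5 * u) + (x^2 - x^4 - 3) * c"
    unfolding u_def c_def by (simp add: ring_distribs eval_nat_numeral mult_ac)
  also have "\<dots> \<in> rad" by (intro rad_add five c)
  finally obtain f where f: "f^3 - f \<in> K" "f - (x - u) \<in> rad"
    by (rule tripotent_lift[OF thirty])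
  have "x - e - f = - (e - u) - (f - (x - u))" by (simp add: ring_distribs eval_nat_numeral mult_ac)
  also have "\<dots> \<in> rad" by (intro rad_diff rad_minus e(2) f(2))
  finally show thesis using that e(1) f(1) by blast
qed

text \<open>The polynomial is \<open>(z-2)(z-1)z(z+1)(z+2)\<close>. It vanishes at every sum of two elements of
  \<open>{-1, 0, 1}\<close>, and therefore at \<open>s + t\<close> modulo \<open>s\<^sup>3 - s\<close> and \<open>t\<^sup>3 - t\<close>; adding \<open>w\<close> changes it by a
  multiple of \<open>w\<close>.\<close>

lemma quintic_of_tripotent_sum:
  assumes "s^3 - s \<in> rad" "t^3 - t \<in> rad" "w \<in> rad"
  shows "(s + t + w)^5 - 5 * (s + t + w)^3 + 4 * (s + t + w) \<in> rad"
proof -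
  define z where "z = s + t"
  have "z^5 - 5 * z^3 + 4 * z
      = (s^2 - 4 + 5 * s * t + 10 * t^2) * (s^3 - s)
        + (t^2 - 4 + 5 * s * t + 10 * s^2) * (t^3 - t)"
    unfolding z_def by (simp add: ring_distribs eval_nat_numeral mult_ac)
  also have "\<dots> \<in> rad" by (intro rad_add rad_mult assms)
  finally have z: "z^5 - 5 * z^3 + 4 * z \<in> rad" .
  have shift: "(z + w)^5 - 5 * (z + w)^3 + 4 * (z + w)
      = (z^5 - 5 * z^3 + 4 * z)
        + (5 * z^4 + 10 * z^3 * w + 10 * z^2 * w^2 + 5 * z * w^3 + w^4
            - 5 * (3 * z^2 + 3 * z * w + w^2) + 4) * w"
    by (simp add: ring_distribs eval_nat_numeral mult_ac)
  have "(z + w)^5 - 5 * (z + w)^3 + 4 * (z + w) \<in> rad"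
    unfolding shift by (rule rad_add[OF z rad_mult[OF assms(3)]])
  then show ?thesis unfolding z_def .
qed

end

section \<open>Commutative rings acting through a homomorphism\<close>

text \<open>The image of \<open>h\<close> is commutative even where \<open>R\<close> is not. Equations between elements
  of the image can thus be verified in the commutative source, modulo the kernel of \<open>h\<close>.\<close>

locale comm_hom = ring R for R :: "('a, 'm) ring_scheme" (structure) +
  fixes h :: "'c::comm_ring_1 \<Rightarrow> 'a"
  assumes closed [simp]: "h x \<in> carrier R"
    and hom_add: "h (x + y) = h x \<oplus> h y"
    and hom_mult: "h (x * y) = h x \<otimes> h y"
    and hom_one: "h 1 = \<one>"
begin

lemma hom_zero: "h 0 = \<zero>"
  using hom_add[of 0 0] by simp

lemma hom_minus: "h (- x) = \<ominus> h x"
  using hom_add[of "- x" x] by (simp add: hom_zero minus_equality)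

lemma hom_diff: "h (x - y) = h x \<ominus> h y"
  using hom_add[of x "- y"] by (simp add: hom_minus a_minus_def)

lemma hom_power: "h (x ^ n) = h x [^] n"
  by (induction n) (simp_all add: hom_one hom_mult power_Suc2 del: power_Suc)

lemma hom_commute: "h x \<otimes> h y = h y \<otimes> h x"
  by (metis hom_mult mult.commute)

sublocale ker: comm_ideal "{x. h x = \<zero>}"
  by unfold_locales (auto simp: hom_zero hom_add hom_mult)

lemma nilpotent_iff: "nilpotent R (h x) \<longleftrightarrow> x \<in> ker.rad"
  by (simp add: nilpotent_def ker.rad_def hom_power)

lemma ker_diff_iff: "h (x - y) = \<zero> \<longleftrightarrow> h x = h y"
proof
  assume "h (x - y) = \<zero>"
  then show "h x = h y" using hom_add[of "x - y" y] by simp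
next
  assume "h x = h y"
  then show "h (x - y) = \<zero>" by (simp add: hom_diff a_minus_def r_neg)
qed

lemma tripotent_iff: "tripotent R (h x) \<longleftrightarrow> x^3 - x \<in> {x. h x = \<zero>}"
  by (simp add: tripotent_def ker_diff_iff hom_power)

lemma two_idempotent_iff: "two_idempotent R (h x) \<longleftrightarrow> x^4 - x^2 \<in> {x. h x = \<zero>}"
  by (simp add: two_idempotent_def ring_idempotent_def ker_diff_iff hom_power nat_pow_pow)

lemma commute3: "commute3 R (h x) (h y) (h z)"
  by (simp add: commute3_def hom_commute)

end

section \<open>Evaluating polynomials at commuting elements\<close>

text \<open>The coefficients come through a homomorphism from an arbitrary commutative ring, so that the
  construction can be iterated: evaluating an element of \<open>\<int>[X][Y][Z]\<close> at three commuting elements is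
  evaluating three times in succession.\<close>

definition poly_hom :: "('a, 'm) ring_scheme \<Rightarrow> ('c::comm_ring_1 \<Rightarrow> 'a) \<Rightarrow> 'a \<Rightarrow> 'c poly \<Rightarrow> 'a" where
  "poly_hom R h x p = (\<Oplus>\<^bsub>R\<^esub>i\<in>{..degree p}. h (coeff p i) \<otimes>\<^bsub>R\<^esub> x [^]\<^bsub>R\<^esub> (i::nat))"

context comm_hom
begin

context
  fixes x
  assumes x [simp]: "x \<in> carrier R"
    and comm: "\<And>c. h c \<otimes> x = x \<otimes> h c"
begin

lemma poly_hom_closed [simp]: "poly_hom R h x p \<in> carrier R"
  unfolding poly_hom_def by (intro finsum_closed) auto

lemma poly_hom_eq_sum:
  assumes "degree p \<le> n"
  shows "poly_hom R h x p = (\<Oplus>i\<in>{..n}. h (coeff p i) \<otimes> x [^] i)"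
  using assms
proof (induction n rule: dec_induct)
  case base
  then show ?case by (simp add: poly_hom_def)
next
  case (step n)
  then have "coeff p (Suc n) = 0" by (simp add: coeff_eq_0)
  with step show ?case by (simp add: hom_zero)
qed

lemma poly_hom_add: "poly_hom R h x (p + q) = poly_hom R h x p \<oplus> poly_hom R h x q"
proof -
  define n where "n = max (degree p) (degree q)"
  have "poly_hom R h x (p + q)
      = (\<Oplus>i\<in>{..n}. h (coeff p i) \<otimes> x [^] i \<oplus> h (coeff q i) \<otimes> x [^] i)"
    by (subst poly_hom_eq_sum[of _ n]) (simp_all add: n_def degree_add_le_max hom_add l_distr)
  also have "\<dots> = poly_hom R h x p \<oplus> poly_hom R h x q"
    by (simp add: finsum_addf poly_hom_eq_sum[of _ n] n_def)
  finally show ?thesis .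
qed

lemma poly_hom_0: "poly_hom R h x 0 = \<zero>"
  by (simp add: poly_hom_def hom_zero)

lemma poly_hom_pCons: "poly_hom R h x (pCons c p) = h c \<oplus> poly_hom R h x p \<otimes> x"
proof -
  have "poly_hom R h x (pCons c p)
      = (\<Oplus>i\<in>{..Suc (degree p)}. h (coeff (pCons c p) i) \<otimes> x [^] i)"
    by (intro poly_hom_eq_sum degree_pCons_le)
  also have "\<dots> = (\<Oplus>i\<in>{..degree p}. h (coeff p i) \<otimes> x [^] i \<otimes> x) \<oplus> h c"
    by (subst finsum_Suc2) (simp_all add: m_assoc)
  also have "\<dots> = h c \<oplus> poly_hom R h x p \<otimes> x"
    by (simp add: poly_hom_def finsum_ldistr a_comm)
  finally show ?thesis .
qed

lemma poly_hom_const: "poly_hom R h x [:c:] = h c"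
  by (simp add: poly_hom_pCons poly_hom_0)

lemma poly_hom_X: "poly_hom R h x [:0, 1:] = x"
  by (simp add: poly_hom_pCons poly_hom_0 hom_zero hom_one)

text \<open>This keeps the hypothesis of the construction alive under iteration: an element that commutes
  with the coefficients and with \<open>x\<close> may serve as the next evaluation point.\<close>

lemma poly_hom_commute:
  assumes y: "y \<in> carrier R" and "\<And>c. h c \<otimes> y = y \<otimes> h c" and xy: "x \<otimes> y = y \<otimes> x"
  shows "poly_hom R h x p \<otimes> y = y \<otimes> poly_hom R h x p"
proof (induction p)
  case 0
  then show ?case using y by (simp add: poly_hom_0)
next
  case (pCons c p)
  have "poly_hom R h x p \<otimes> x \<otimes> y = poly_hom R h x p \<otimes> y \<otimes> x"
    using y by (simp add: m_assoc xy)
  also have "\<dots> = y \<otimes> (poly_hom R h x p \<otimes> x)"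
    using y by (simp add: pCons.IH m_assoc)
  finally show ?case
    using y assms(2) by (simp add: poly_hom_pCons l_distr r_distr)
qed

lemma poly_hom_smult: "poly_hom R h x (smult c p) = h c \<otimes> poly_hom R h x p"
  by (induction p) (simp_all add: poly_hom_pCons poly_hom_0 hom_mult r_distr m_assoc)

lemma poly_hom_mult: "poly_hom R h x (p * q) = poly_hom R h x p \<otimes> poly_hom R h x q"
proof (induction p)
  case 0
  then show ?case by (simp add: poly_hom_0)
next
  case (pCons c p)
  have *: "x \<otimes> poly_hom R h x q = poly_hom R h x q \<otimes> x"
    by (rule poly_hom_commute[symmetric]) (simp_all add: comm)
  have "poly_hom R h x p \<otimes> poly_hom R h x q \<otimes> x = poly_hom R h x p \<otimes> x \<otimes> poly_hom R h x q"
    by (simp add: m_assoc *)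
  then show ?case
    by (simp add: pCons.IH poly_hom_add poly_hom_smult poly_hom_pCons hom_zero l_distr)
qed

lemma comm_hom_poly_hom: "comm_hom R (poly_hom R h x)"
proof unfold_locales
  show "poly_hom R h x 1 = \<one>"
    using poly_hom_const[of 1] by (simp add: hom_one one_pCons)
qed (simp_all add: poly_hom_add poly_hom_mult)

end

end

section \<open>Integer polynomials and the ring\<close>

context ring
begin

lemma comm_hom_int: "comm_hom R (\<lambda>k::int. [k] \<cdot> \<one>)"
proof unfold_locales
  fix k l :: int
  show "[(k * l)] \<cdot> \<one> = [k] \<cdot> \<one> \<otimes> [l] \<cdot> \<one>"
    by (simp add: add_pow_ldistr_int add.int_pow_pow mult.commute)
qed (auto simp: add.int_pow_mult)

lemma int_multiple_commute:
  assumes "a \<in> carrier R"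
  shows "[(k::int)] \<cdot> \<one> \<otimes> a = a \<otimes> [k] \<cdot> \<one>"
  using assms by (simp add: add_pow_ldistr_int add_pow_rdistr_int)

lemma int_poly_eval_eq_poly_hom:
  assumes "a \<in> carrier R"
  shows "int_poly_eval R p a = poly_hom R (\<lambda>k::int. [k] \<cdot> \<one>) a p"
  using assms by (simp add: int_poly_eval_def poly_hom_def add_pow_ldistr_int)

lemma comm_hom_int_poly_eval:
  assumes "a \<in> carrier R"
  shows "comm_hom R (\<lambda>p. int_poly_eval R p a)"
  using comm_hom.comm_hom_poly_hom[OF comm_hom_int assms int_multiple_commute[OF assms]] assms
  by (simp add: int_poly_eval_eq_poly_hom)

lemma int_poly_eval_X:
  assumes "a \<in> carrier R"
  shows "int_poly_eval R [:0, 1:] a = a"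
  using comm_hom.poly_hom_X[OF comm_hom_int assms int_multiple_commute[OF assms]] assms
  by (simp add: int_poly_eval_eq_poly_hom)

text \<open>Three commuting elements lie in a commutative image of \<open>\<int>[X][Y][Z]\<close>: this is how the
  commutative calculations apply to a decomposition in a noncommutative ring.\<close>

lemma commuting_triple_comm_hom:
  assumes c: "s \<in> carrier R" "t \<in> carrier R" "w \<in> carrier R" and "commute3 R s t w"
  obtains h :: "int poly poly poly \<Rightarrow> 'a" and x y z
  where "comm_hom R h" "h x = s" "h y = t" "h z = w"
proof -
  have st: "s \<otimes> t = t \<otimes> s" and sw: "s \<otimes> w = w \<otimes> s" and tw: "t \<otimes> w = w \<otimes> t"
    using assms(4) by (simp_all add: commute3_def)
  define h0 where "h0 = (\<lambda>k::int. [k] \<cdot> \<one>)"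
  define h1 where "h1 = poly_hom R h0 s"
  define h2 where "h2 = poly_hom R h1 t"
  define h3 where "h3 = poly_hom R h2 w"
  have 0: "comm_hom R h0" unfolding h0_def by (rule comm_hom_int)
  have c0: "h0 k \<otimes> a = a \<otimes> h0 k" if "a \<in> carrier R" for k a
    unfolding h0_def using that by (rule int_multiple_commute)
  have 1: "comm_hom R h1"
    unfolding h1_def by (intro comm_hom.comm_hom_poly_hom 0 c0 c)
  have c1: "h1 p \<otimes> a = a \<otimes> h1 p" if "a \<in> carrier R" "s \<otimes> a = a \<otimes> s" for p a
    unfolding h1_def by (intro comm_hom.poly_hom_commute[OF 0] c0 c that)
  have 2: "comm_hom R h2"
    unfolding h2_def by (intro comm_hom.comm_hom_poly_hom 1 c1 c st)
  have c2: "h2 p \<otimes> w = w \<otimes> h2 p" for p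
    unfolding h2_def by (intro comm_hom.poly_hom_commute[OF 1] c1 c st sw tw)
  have 3: "comm_hom R h3"
    unfolding h3_def by (intro comm_hom.comm_hom_poly_hom 2 c2 c)
  show thesis
  proof (rule that[OF 3])
    show "h3 [:0, 1:] = w"
      unfolding h3_def by (intro comm_hom.poly_hom_X[OF 2] c c2)
    have h3: "h3 [:p:] = h2 p" for p
      unfolding h3_def by (intro comm_hom.poly_hom_const[OF 2] c c2)
    show "h3 [:[:0, 1:]:] = t"
      unfolding h3 unfolding h2_def by (intro comm_hom.poly_hom_X[OF 1] c c1 st)
    have h2: "h2 [:p:] = h1 p" for p
      unfolding h2_def by (intro comm_hom.poly_hom_const[OF 1] c c1 st)
    show "h3 [:[:[:0, 1:]:]:] = s"
      unfolding h3 h2 unfolding h1_def by (intro comm_hom.poly_hom_X[OF 0] c c0)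
  qed
qed

end

section \<open>Zhou nil-clean rings\<close>

context comm_hom
begin

lemma hom_of_nat: "h (of_nat n) = [n] \<cdot> \<one>"
  by (induction n) (simp_all add: hom_zero hom_add hom_one a_comm)

text \<open>The value of the quintic depends only on the element of \<open>R\<close>, not on the polynomial ring in
  which it is represented. This carries nilpotency from the three-variable ring, where the given
  decomposition lives, to \<open>\<int>[a]\<close>, where the new one is sought.\<close>

lemma hom_quintic_cong:
  assumes "comm_hom R h'" "h x = h' y"
  shows "h (x^5 - 5 * x^3 + 4 * x) = h' (y^5 - 5 * y^3 + 4 * y)"
proof -
  interpret h': comm_hom R h' by fact
  have "h (of_nat n) = h' (of_nat n)" for n
    by (simp only: hom_of_nat h'.hom_of_nat)
  from this[of 5] this[of 4] have "h 5 = h' 5" "h 4 = h' 4" by simp_all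
  with assms(2) show ?thesis
    by (simp add: hom_add hom_diff hom_mult hom_power
        h'.hom_add h'.hom_diff h'.hom_mult h'.hom_power)
qed

lemma zhou_nil_clean_quintic:
  assumes "zhou_nil_clean R"
  shows "x^5 - 5 * x^3 + 4 * x \<in> ker.rad"
proof -
  obtain s t w where stw: "tripotent R s" "tripotent R t" "nilpotent R w" "commute3 R s t w"
      and hx: "h x = s \<oplus> t \<oplus> w"
    using assms by (auto simp: zhou_nil_clean_def dest: bspec[of _ _ "h x"])
  obtain h' :: "int poly poly poly \<Rightarrow> 'a" and a b c
    where h': "comm_hom R h'" and abc: "h' a = s" "h' b = t" "h' c = w"
    using commuting_triple_comm_hom[OF _ _ _ stw(4)] stw(1-3)
    unfolding tripotent_def nilpotent_def by metis
  interpret h': comm_hom R h' by fact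
  define y where "y = a + b + c"
  have "y^5 - 5 * y^3 + 4 * y \<in> h'.ker.rad"
    unfolding y_def
  proof (rule h'.ker.quintic_of_tripotent_sum)
    show "a^3 - a \<in> h'.ker.rad" "b^3 - b \<in> h'.ker.rad"
      using stw(1,2) unfolding abc[symmetric] h'.tripotent_iff by (simp_all only: h'.ker.mem_rad)
    show "c \<in> h'.ker.rad"
      using stw(3) unfolding abc[symmetric] h'.nilpotent_iff .
  qed
  moreover have "h x = h' y"
    by (simp add: y_def hx abc h'.hom_add)
  ultimately show ?thesis
    using hom_quintic_cong[OF h', of x y] by (simp flip: nilpotent_iff h'.nilpotent_iff)
qed

text \<open>The smallest positive integer at which the quintic is nonzero is 3, with value
  \<open>1 \<cdot> 2 \<cdot> 3 \<cdot> 4 \<cdot> 5 = 120\<close>; and 120 divides \<open>30\<^sup>3\<close>.\<close>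

lemma zhou_nil_clean_thirty:
  assumes "zhou_nil_clean R"
  shows "30 \<in> ker.rad"
proof -
  have "(120 :: 'c) \<in> ker.rad"
    using zhou_nil_clean_quintic[OF assms, of 3] by simp
  then have "225 * (120 :: 'c) \<in> ker.rad" by (rule ker.rad_mult)
  then have "(30 :: 'c) ^ 3 \<in> ker.rad" by simp
  then show ?thesis by (rule ker.rad_powerD)
qed

lemma two_idempotent_if_tripotent:
  assumes "tripotent R (h x)"
  shows "two_idempotent R (h x)"
proof -
  have "x^4 - x^2 = x * (x^3 - x)" by (simp add: ring_distribs eval_nat_numeral mult_ac)
  then show ?thesis
    using assms unfolding tripotent_iff two_idempotent_iff by (simp only: ker.mult_mem)
qed

text \<open>Since \<open>x\<^sup>4 = x\<^sup>2\<close>, powers of \<open>x\<close> from the second on depend only on the parity of the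
  exponent. So \<open>x\<^sup>9 = x\<^sup>3\<close>, and \<open>(x - x\<^sup>3)\<^sup>2 = x\<^sup>2 - 2x\<^sup>4 + x\<^sup>6 = 0\<close>.\<close>

lemma tripotent_cube_if_two_idempotent:
  assumes "two_idempotent R (h x)"
  shows "tripotent R (h (x^3))" and "x - x^3 \<in> ker.rad"
proof -
  note x = assms[unfolded two_idempotent_iff]
  have "(x^3)^3 - x^3 = (x^5 + x^3 + x) * (x^4 - x^2)" by (simp add: ring_distribs eval_nat_numeral mult_ac)
  then show "tripotent R (h (x^3))"
    using x unfolding tripotent_iff by (simp only: ker.mult_mem)
  have "(x - x^3)^2 = (x^2 - 1) * (x^4 - x^2)" by (simp add: ring_distribs eval_nat_numeral mult_ac)
  then have "(x - x^3)^2 \<in> {x. h x = \<zero>}"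
    using x by (simp only: ker.mult_mem)
  then show "x - x^3 \<in> ker.rad" by (rule ker.radI)
qed

lemma two_idempotents_sum_decomposition:
  assumes "two_idempotent R (h x)" "two_idempotent R (h y)" "nilpotent R (h z)"
  shows "\<exists>s t w. tripotent R s \<and> tripotent R t \<and> nilpotent R w \<and> commute3 R s t w \<and>
    h (x + y + z) = s \<oplus> t \<oplus> w"
proof (intro exI conjI)
  define v where "v = (x - x^3) + (y - y^3) + z"
  show "tripotent R (h (x^3))" "tripotent R (h (y^3))"
    using assms by (simp_all add: tripotent_cube_if_two_idempotent)
  show "nilpotent R (h v)"
    unfolding v_def nilpotent_iff using assms
    by (intro ker.rad_add tripotent_cube_if_two_idempotent) (simp_all add: nilpotent_iff)
  show "commute3 R (h (x^3)) (h (y^3)) (h v)" by (rule commute3)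
  have "x + y + z = x^3 + y^3 + v" by (simp add: v_def)
  then show "h (x + y + z) = h (x^3) \<oplus> h (y^3) \<oplus> h v"
    by (simp only: hom_add)
qed

end

context ring
begin

lemma zhou_nil_clean_imp_int_adjoin:
  assumes "zhou_nil_clean R" "a \<in> carrier R"
  shows "\<exists>e\<in>int_adjoin R a. \<exists>f\<in>int_adjoin R a. \<exists>w.
    two_idempotent R e \<and> two_idempotent R f \<and> nilpotent R w \<and> a = e \<oplus> f \<oplus> w"
proof -
  interpret h: comm_hom R "\<lambda>p. int_poly_eval R p a"
    using assms(2) by (rule comm_hom_int_poly_eval)
  define x :: "int poly" where "x = [:0, 1:]"
  obtain e f where e: "e^3 - e \<in> {p. int_poly_eval R p a = \<zero>}"
      and f: "f^3 - f \<in> {p. int_poly_eval R p a = \<zero>}" and w: "x - e - f \<in> h.ker.rad"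
    using h.ker.two_tripotents_decomposition
      h.zhou_nil_clean_thirty[OF assms(1)] h.zhou_nil_clean_quintic[OF assms(1)] .
  have "x = e + f + (x - e - f)" by simp
  then have "a = int_poly_eval R e a \<oplus> int_poly_eval R f a \<oplus> int_poly_eval R (x - e - f) a"
    using int_poly_eval_X[OF assms(2)] unfolding x_def[symmetric] by (metis h.hom_add)
  then show ?thesis
    using e f w unfolding int_adjoin_def
    by (blast intro: h.two_idempotent_if_tripotent h.tripotent_iff[THEN iffD2] h.nilpotent_iff[THEN iffD2])
qed

text \<open>The third summand is \<open>a - e - f\<close>, so it lies in the commutative ring \<open>\<int>[a]\<close> as well.\<close>

lemma int_adjoin_commute3:
  assumes a: "a \<in> carrier R" and "e \<in> int_adjoin R a" "f \<in> int_adjoin R a" "w \<in> carrier R"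
    and sum: "a = e \<oplus> f \<oplus> w"
  shows "commute3 R e f w"
proof -
  interpret h: comm_hom R "\<lambda>p. int_poly_eval R p a"
    using a by (rule comm_hom_int_poly_eval)
  obtain p q where e: "e = int_poly_eval R p a" and f: "f = int_poly_eval R q a"
    using assms(2,3) by (auto simp: int_adjoin_def)
  have ef: "e \<in> carrier R" "f \<in> carrier R" by (simp_all add: e f)
  have "w = a \<ominus> (e \<oplus> f)"
    using ef assms(4) unfolding sum
    by (simp add: a_minus_def a_comm[of _ w] a_assoc r_neg)
  also have "\<dots> = int_poly_eval R ([:0, 1:] - (p + q)) a"
    by (simp only: h.hom_diff h.hom_add e f int_poly_eval_X[OF a])
  finally show ?thesis unfolding e f by (simp only: h.commute3)
qed

lemma zhou_nil_clean_if_two_idempotents: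
  assumes "\<forall>a\<in>carrier R. \<exists>e f w. two_idempotent R e \<and> two_idempotent R f \<and> nilpotent R w \<and>
    commute3 R e f w \<and> a = e \<oplus> f \<oplus> w"
  shows "zhou_nil_clean R"
  unfolding zhou_nil_clean_def
proof
  fix a assume "a \<in> carrier R"
  with assms obtain e f w where efw: "two_idempotent R e" "two_idempotent R f" "nilpotent R w"
      and "commute3 R e f w" and a: "a = e \<oplus> f \<oplus> w"
    by blast
  then obtain h :: "int poly poly poly \<Rightarrow> 'a" and x y z
    where "comm_hom R h" and xyz: "h x = e" "h y = f" "h z = w"
    using commuting_triple_comm_hom[of e f w] unfolding two_idempotent_def nilpotent_def by metis
  interpret comm_hom R h by fact
  have "h (x + y + z) = a" by (simp add: a xyz hom_add)
  then show "\<exists>s t w. tripotent R s \<and> tripotent R t \<and> nilpotent R w \<and> commute3 R s t w \<and>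
      a = s \<oplus> t \<oplus> w"
    using two_idempotents_sum_decomposition[of x y z] efw xyz by simp
qed

end

theorem theorem3p2:
  fixes R :: "('a, 'm) ring_scheme" (structure)
  assumes "ring R"
  shows
    "(zhou_nil_clean R \<longleftrightarrow>
       (\<forall>a\<in>carrier R. \<exists>e\<in>int_adjoin R a. \<exists>f\<in>int_adjoin R a. \<exists>w.
          two_idempotent R e \<and> two_idempotent R f \<and> nilpotent R w \<and> a = e \<oplus> f \<oplus> w)) \<and>
     (zhou_nil_clean R \<longleftrightarrow>
       (\<forall>a\<in>carrier R. \<exists>e f w.
          two_idempotent R e \<and> two_idempotent R f \<and> nilpotent R w \<and>
          commute3 R e f w \<and> a = e \<oplus> f \<oplus> w))"
  (is "(_ \<longleftrightarrow> ?adjoin) \<and> (_ \<longleftrightarrow> ?commuting)")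
proof -
  interpret ring R by fact
  have "?adjoin" if "zhou_nil_clean R"
    using zhou_nil_clean_imp_int_adjoin[OF that] by blast
  moreover have "?commuting" if ?adjoin
  proof
    fix a assume a: "a \<in> carrier R"
    with that obtain e f w where ef: "e \<in> int_adjoin R a" "f \<in> int_adjoin R a"
      and efw: "two_idempotent R e" "two_idempotent R f" "nilpotent R w" "a = e \<oplus> f \<oplus> w"
      by blast
    then have "commute3 R e f w"
      by (intro int_adjoin_commute3[OF a]) (auto simp: nilpotent_def)
    with efw show "\<exists>e f w. two_idempotent R e \<and> two_idempotent R f \<and> nilpotent R w \<and>
        commute3 R e f w \<and> a = e \<oplus> f \<oplus> w"
      by blast
  qed
  moreover have "zhou_nil_clean R" if ?commuting
    using that by (rule zhou_nil_clean_if_two_idempotents)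
  ultimately show ?thesis by blast
qed

end
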